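(* Let $N>2$ be an integer, $b>1$, $p\in(0,1)$, and let the prior be the truncated geometric distribution \[ \pi_k=\frac{p(1-p)^{k-1}}{1-(1-p)^N},\qquad k=1,\dots,N \] (so the horizon bound is $M=N$). Let $E_1=\sum_{k=1}^N k\,\pi_k$. Then the Bayesian ski rental algorithm with buy cost $b$ and prior $\pi$ has expected competitive ratio \[ \mathrm{ECR}=\frac{\min(E_1,b)}{\sum_{k=1}^N \pi_k\min(k,b)}. \]
   Context: Ski rental: the unknown season length (horizon) $T\in\{1,\dots,M\}$ has prior $\Pr[T=k]=\pi_k\ge 0$ with $\sum_{k=1}^M\pi_k=1$. Renting costs $1$ per day; buying costs a one-time amount $b>1$ and then use is free. For $t\in\{1,\dots,M\}$ put $Z_t=\sum_{k=t}^M\pi_k$ and, when $Z_t>0$, define the expected remaining rental cost \[E_{\mathrm{rent}}(t)=\sum_{k=t}^M \frac{\pi_k}{Z_t}\,(k-t+1).\] Bayesian algorithm: it buys on the first day $t$ with $Z_t>0$ and $b\le E_{\mathrm{rent}}(t)$, and rents on every day before that. Its purchase day $t^*$ is this first day $t$, with $t^*=M+1$ if there is no such day (never buy). Expected competitive ratio (ratio of the algorithm's expected cost to the expected offline optimal cost, the offline optimal cost for horizon $k$ being $\min(k,b)$): \[ \mathrm{ECR}=\frac{\sum_{k=1}^{t^*-1}\pi_k\,k+\sum_{k=t^*}^{M}\pi_k\,(t^*-1+b)}{\sum_{k=1}^{M}\pi_k\min(k,b)}. \] *)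

theory Defs
  imports Complex_Main
begin

text \<open>
  A prior is a function \<open>\<pi> :: nat \<Rightarrow> real\<close>, of which only the values on \<open>{1..M}\<close> matter,
  where \<open>M\<close> is the largest possible horizon. Renting costs \<open>1\<close> per day and buying costs \<open>b\<close>.
\<close>

definition tail_mass :: "nat \<Rightarrow> (nat \<Rightarrow> real) \<Rightarrow> nat \<Rightarrow> real" where
  "tail_mass M \<pi> t = (\<Sum>k=t..M. \<pi> k)"

text \<open>Only meaningful when \<open>tail_mass M \<pi> t > 0\<close>; every use below is guarded accordingly.\<close>

definition exp_rent :: "nat \<Rightarrow> (nat \<Rightarrow> real) \<Rightarrow> nat \<Rightarrow> real" where
  "exp_rent M \<pi> t = (\<Sum>k=t..M. \<pi> k / tail_mass M \<pi> t * (real k - real t + 1))"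

definition buy_condition :: "real \<Rightarrow> nat \<Rightarrow> (nat \<Rightarrow> real) \<Rightarrow> nat \<Rightarrow> bool" where
  "buy_condition b M \<pi> t \<longleftrightarrow>
     t \<in> {1..M} \<and> tail_mass M \<pi> t > 0 \<and> b \<le> exp_rent M \<pi> t"

text \<open>The value \<open>M + 1\<close> encodes that the algorithm never buys.\<close>

definition purchase_day :: "real \<Rightarrow> nat \<Rightarrow> (nat \<Rightarrow> real) \<Rightarrow> nat" where
  "purchase_day b M \<pi> =
     (if \<exists>t. buy_condition b M \<pi> t then LEAST t. buy_condition b M \<pi> t else M + 1)"

text \<open>
  Expected cost of renting on the days before \<open>s\<close> and buying on day \<open>s\<close>:
  a horizon \<open>k < s\<close> costs \<open>k\<close>, any other horizon costs \<open>s - 1 + b\<close>.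
\<close>

definition exp_cost :: "real \<Rightarrow> nat \<Rightarrow> (nat \<Rightarrow> real) \<Rightarrow> nat \<Rightarrow> real" where
  "exp_cost b M \<pi> s = (\<Sum>k=1..<s. \<pi> k * real k) + (\<Sum>k=s..M. \<pi> k * (real s - 1 + b))"

definition exp_opt_cost :: "real \<Rightarrow> nat \<Rightarrow> (nat \<Rightarrow> real) \<Rightarrow> real" where
  "exp_opt_cost b M \<pi> = (\<Sum>k=1..M. \<pi> k * min (real k) b)"

definition ECR :: "real \<Rightarrow> nat \<Rightarrow> (nat \<Rightarrow> real) \<Rightarrow> real" where
  "ECR b M \<pi> = exp_cost b M \<pi> (purchase_day b M \<pi>) / exp_opt_cost b M \<pi>"

definition trunc_geometric :: "real \<Rightarrow> nat \<Rightarrow> nat \<Rightarrow> real" where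
  "trunc_geometric p N k = p * (1 - p) ^ (k - 1) / (1 - (1 - p) ^ N)"

end

theory Submission imports Defs begin

text \<open>
  By memorylessness, the remaining season seen from day \<open>s + 1\<close> is again truncated geometric, with
  bound \<open>N - s\<close>. Truncating earlier lowers the mean, so the expected remaining rental cost is
  largest on day 1, where it is \<open>E\<^sub>1\<close>. Hence the algorithm either buys at once (cost \<open>b\<close>, when
  \<open>b \<le> E\<^sub>1\<close>) or never (cost \<open>E\<^sub>1\<close>, when \<open>E\<^sub>1 < b\<close>).
\<close>

text \<open>Each step of the induction adds the point \<open>Suc n\<close>, which exceeds every
  point averaged so far, so the weighted mean cannot drop.\<close>

lemma truncated_mean_mono:
  fixes w :: "nat \<Rightarrow> real"
  assumes pos: "\<And>j. 0 < w j" and "1 \<le> m" and "m \<le> n"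
  shows "(\<Sum>j=1..m. w j * real j) / (\<Sum>j=1..m. w j) \<le> (\<Sum>j=1..n. w j * real j) / (\<Sum>j=1..n. w j)"
  using \<open>m \<le> n\<close>
proof (induction n rule: dec_induct)
  case base
  show ?case by simp
next
  case (step n)
  let ?S = "\<Sum>j=1..n. w j * real j" and ?W = "\<Sum>j=1..n. w j"
  have W: "0 < ?W"
    using \<open>1 \<le> m\<close> step.hyps by (intro sum_pos pos) auto
  have "?S \<le> (\<Sum>j=1..n. w j * real (Suc n))"
    by (intro sum_mono mult_left_mono) (auto intro: less_imp_le pos)
  also have "\<dots> = ?W * real (Suc n)"
    by (simp only: sum_distrib_right)
  finally have "?S * w (Suc n) \<le> ?W * real (Suc n) * w (Suc n)"
    using pos[of "Suc n"] by (intro mult_right_mono) auto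
  \<comment> \<open>Adding \<open>?S * ?W\<close> to both sides gives the comparison of the two
    means with denominators cleared.\<close>
  then have "?S * (?W + w (Suc n)) \<le> (?S + w (Suc n) * real (Suc n)) * ?W"
    by (simp only: algebra_simps)
  then have "?S / ?W \<le> (?S + w (Suc n) * real (Suc n)) / (?W + w (Suc n))"
    using W pos[of "Suc n"] by (simp add: divide_simps)
  also have "\<dots> = (\<Sum>j=1..Suc n. w j * real j) / (\<Sum>j=1..Suc n. w j)"
    by simp
  finally show ?case
    using step.IH by linarith
qed

lemma trunc_geometric_pos:
  assumes "0 < N" and "0 < p" and "p < 1"
  shows "0 < trunc_geometric p N k"
  using assms by (simp add: trunc_geometric_def power_less_one_iff)

text \<open>This is memorylessness. The bound on \<open>j\<close> matters because
  \<open>k - 1\<close> is truncated subtraction: at \<open>j = 0\<close> the exponent would be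
  \<open>s - 1\<close> instead of \<open>s\<close> for positive \<open>s\<close>.\<close>

lemma trunc_geometric_shift:
  assumes "1 \<le> j"
  shows "trunc_geometric p N (j + s) = (1 - p) ^ s * trunc_geometric p N j"
proof -
  have "j + s - 1 = s + (j - 1)"
    using assms by simp
  then show ?thesis
    by (simp add: trunc_geometric_def power_add)
qed

lemma sum_trunc_geometric:
  assumes "0 < N" and "0 < p" and "p < 1"
  shows "(\<Sum>k=1..N. trunc_geometric p N k) = 1"
proof -
  have "(\<Sum>k=1..N. (1 - p) ^ (k - 1)) = (\<Sum>k<N. (1 - p) ^ k)"
    by (rule sum.reindex_bij_witness[of _ Suc "\<lambda>k. k - 1"]) auto
  also have "p * \<dots> = 1 - (1 - p) ^ N"
    using one_diff_power_eq[of "1 - p" N] by simp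
  finally have "p * (\<Sum>k=1..N. (1 - p) ^ (k - 1)) = 1 - (1 - p) ^ N" .
  moreover have "(1 - p) ^ N < 1"
    using assms by (simp add: power_less_one_iff)
  ultimately show ?thesis
    by (simp add: trunc_geometric_def flip: sum_divide_distrib sum_distrib_left)
qed

text \<open>Substituting \<open>k = j + s\<close> turns the remaining rent \<open>k - t + 1\<close>
  into \<open>j\<close>. The factor \<open>(1 - p) ^ s\<close>, nonzero since \<open>p < 1\<close>,
  then cancels between the weights and the tail mass. The weights keep the normalisation for
  \<open>N\<close>, so different days differ only in the summation range.\<close>

lemma exp_rent_trunc_geometric:
  assumes "s < N" and "p < 1"
  shows "exp_rent N (trunc_geometric p N) (Suc s) =
    (\<Sum>j=1..N - s. trunc_geometric p N j * real j) / (\<Sum>j=1..N - s. trunc_geometric p N j)"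
proof -
  let ?g = "trunc_geometric p N"
  have shift: "sum f {Suc s..N} = (\<Sum>j=1..N - s. f (j + s))" for f :: "nat \<Rightarrow> real"
    using sum.shift_bounds_cl_nat_ivl[of f 1 s "N - s"] assms by simp
  have "tail_mass N ?g (Suc s) = (\<Sum>j=1..N - s. (1 - p) ^ s * ?g j)"
    unfolding tail_mass_def shift by (intro sum.cong refl trunc_geometric_shift) simp
  also have "\<dots> = (1 - p) ^ s * (\<Sum>j=1..N - s. ?g j)"
    by (simp add: sum_distrib_left)
  finally have tail: "tail_mass N ?g (Suc s) = (1 - p) ^ s * (\<Sum>j=1..N - s. ?g j)" .
  have "exp_rent N ?g (Suc s) = (\<Sum>j=1..N - s. (?g j * real j) / (\<Sum>j=1..N - s. ?g j))"
    unfolding exp_rent_def shift tail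
    using assms by (intro sum.cong refl) (simp add: trunc_geometric_shift)
  then show ?thesis
    by (simp only: sum_divide_distrib)
qed

lemma exp_rent_trunc_geometric_le_first:
  assumes "t \<in> {1..N}" and "0 < p" and "p < 1"
  shows "exp_rent N (trunc_geometric p N) t \<le> exp_rent N (trunc_geometric p N) 1"
proof -
  obtain s where s: "t = Suc s" "s < N"
    using assms by (cases t) auto
  show ?thesis
    using s assms exp_rent_trunc_geometric[of s N p] exp_rent_trunc_geometric[of 0 N p]
      truncated_mean_mono[of "trunc_geometric p N" "N - s" N]
    by (simp add: trunc_geometric_pos)
qed

theorem theorem2:
  fixes N :: nat and b p :: real
  assumes "N > 2" and "b > 1" and "0 < p" and "p < 1"
  shows "ECR b N (trunc_geometric p N) =
           min (\<Sum>k=1..N. real k * trunc_geometric p N k) b /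
           (\<Sum>k=1..N. trunc_geometric p N k * min (real k) b)"
proof -
  let ?g = "trunc_geometric p N"
  define E where "E = (\<Sum>k=1..N. real k * ?g k)"
  have sum1: "(\<Sum>k=1..N. ?g k) = 1"
    using assms by (intro sum_trunc_geometric) auto
  have rent1: "exp_rent N ?g 1 = E"
    using exp_rent_trunc_geometric[of 0 N p] assms sum1 by (simp add: E_def mult.commute)
  have "exp_cost b N ?g (purchase_day b N ?g) = min E b"
  proof (cases "b \<le> E")
    case True
    have buy: "buy_condition b N ?g 1"
      using True assms sum1 rent1 by (simp add: buy_condition_def tail_mass_def)
    \<comment> \<open>Day 0 is not a candidate, since \<open>buy_condition\<close> restricts days to
      \<open>{1..N}\<close>.\<close>
    then have "(LEAST t. buy_condition b N ?g t) = 1"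
      by (rule Least_equality) (simp add: buy_condition_def)
    with buy have "purchase_day b N ?g = 1"
      by (auto simp: purchase_day_def)
    \<comment> \<open>Buying on day 1 leaves the rental sum empty, and every horizon costs
      \<open>1 - 1 + b = b\<close>.\<close>
    then show ?thesis
      using True sum1 by (simp add: exp_cost_def flip: sum_distrib_right)
  next
    case False
    \<comment> \<open>On every day in range the expected remaining rent is at most \<open>E\<close>,
      hence below \<open>b\<close>.\<close>
    then have "\<not> buy_condition b N ?g t" for t
      using exp_rent_trunc_geometric_le_first[of t N p] assms rent1
      by (auto simp: buy_condition_def)
    then have "purchase_day b N ?g = N + 1"
      by (simp add: purchase_day_def)
    \<comment> \<open>At \<open>N + 1\<close> the purchase sum is empty and the rental sum covers
      all of \<open>{1..N}\<close>, which gives \<open>E\<close>.\<close>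
    then show ?thesis
      using False by (simp add: exp_cost_def E_def mult.commute atLeastLessThanSuc_atLeastAtMost)
  qed
  then show ?thesis
    by (simp add: ECR_def exp_opt_cost_def E_def)
qed

end
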